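(* Let $F=(F_1,\dots,F_m):\mathbb{R}^n\to\mathbb{R}^m$ be continuously differentiable. Suppose that for each $i\in[m]$ the gradient $\nabla F_i$ is Lipschitz continuous with constant $L_i$, and that $F$ satisfies a global error bound with constant $\kappa>0$, i.e. $$u_0(x)\le\kappa\|v(x)\|^2\quad\text{for all }x\in\mathbb{R}^n,$$ where $u_0(x)=\sup_{y\in\mathbb{R}^n}\min_{i\in[m]}\{F_i(x)-F_i(y)\}$ and $v(x)$ is the Barzilai-Borwein descent direction at $x$ (see context). Let $\{x^k\}$ be an infinite sequence of non-Pareto-critical points generated by the subspace minimization Barzilai-Borwein descent method (SMBBMO) described in the context. Then, for all $k\ge 0$, $$u_0(x^{k+1})\le(1-r)\,u_0(x^k),$$ where $$r=\frac{\sigma_1t_{\min}\alpha_{\min}^3}{c_2\kappa\alpha_{\max}^2},\qquad t_{\min}=\frac{(1-\sigma_2)c_1\alpha_{\min}}{2L_{\max}},\qquad L_{\max}=\max_{i\in[m]}L_i.$$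
   Context: Notation: $[m]=\{1,\dots,m\}$; $\Delta_m=\{\lambda\in\mathbb{R}^m:\lambda_i\ge0,\ \sum_i\lambda_i=1\}$; for $\alpha\in\mathbb{R}^m$ with positive entries, $\mathcal{D}_\alpha(x,d)=\max_{i\in[m]}\langle\nabla F_i(x)/\alpha_i,d\rangle$. A point $x^*$ is Pareto critical if there is no $d\in\mathbb{R}^n$ with $\langle\nabla F_i(x^* ),d\rangle<0$ for all $i\in[m]$. Error bound: for $\alpha\in[\alpha_{\min},\alpha_{\max}]^m$, the Barzilai-Borwein descent direction at $x$ with parameter $\alpha$ is $\arg\min_{v\in\mathbb{R}^n}\max_{i\in[m]}\{\langle\nabla F_i(x),v\rangle/\alpha_i+\frac12\|v\|^2\}$; the inequality $u_0(x)\le\kappa\|v(x)\|^2$ is required for $v(x)$ computed with every such $\alpha$ (in particular it gives $u_0(x^k)\le\kappa\|v_k\|^2$ along the iterates, with $v_k$ as below). Parameters of SMBBMO: $0<c_1\le c_2$, $0<\sigma_1\le\sigma_2<1$, $0<\alpha_{\min}<\alpha_{\max}$, a starting point $x^0$ and an auxiliary point $x^{-1}$ near $x^0$. Write $s_{k-1}=x^k-x^{k-1}$ and $y_i^{k-1}=\nabla F_i(x^k)-\nabla F_i(x^{k-1})$. Iteration $k=0,1,2,\dots$: (1) Set $\alpha_i^k=\max\{\alpha_{\min},\min\{\langle s_{k-1},y_i^{k-1}\rangle/\|s_{k-1}\|^2,\alpha_{\max}\}\}$ if $\langle s_{k-1},y_i^{k-1}\rangle>0$; $\alpha_i^k=\max\{\alpha_{\min},\min\{\|y_i^{k-1}\|/\|s_{k-1}\|,\alpha_{\max}\}\}$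 if $\langle s_{k-1},y_i^{k-1}\rangle<0$; $\alpha_i^k=\alpha_{\min}$ if $\langle s_{k-1},y_i^{k-1}\rangle=0$. (2) Compute $v_k=\arg\min_{v\in\mathbb{R}^n}\max_{i\in[m]}\{\langle\nabla F_i(x^k),v\rangle/\alpha_i^k+\frac12\|v\|^2\}$ and a dual solution $\lambda^k\in\Delta_m$ (vector of KKT multipliers of the $m$ inequality constraints in the epigraph reformulation). If $v_k=0$, stop ($x^k$ is Pareto critical). (3) If $k=0$, set $d_0=v_0$, $\bar\lambda^0=\lambda^0$, $\bar\alpha^0=\alpha^0$. (4) If $k\ge1$, set $$y^{k-1}=\sum_{i}\tfrac{\bar\lambda_i^{k-1}}{\bar\alpha_i^{k-1}}(\nabla F_i(x^k)-\nabla F_i(x^{k-1})),\qquad y_v^{k-1}=\sum_i\tfrac{\bar\lambda_i^{k-1}}{\bar\alpha_i^{k-1}}(\nabla F_i(x^k)-\nabla F_i(x^k-v_k)).$$ Set $\rho_1^k=\langle v_k,y_v^{k-1}\rangle$ if this is positive and $\rho_1^k=\|v_k\|\|y_v^{k-1}\|$ otherwise. Set $\rho_2^k=\langle s_{k-1},y^{k-1}\rangle$ if this is positive and $\rho_2^k=\mathcal{D}_{\bar\alpha^{k-1}}(x^k,s_{k-1})-\sum_i\bar\lambda_i^{k-1}\langle\nabla F_i(x^{k-1})/\bar\alpha_i^{k-1},s_{k-1}\rangle$ otherwise (the Wolfe conditions in (5) ensure $\rho_2^k>0$). The matrix $H^k$ is obtained by a modified Cholesky factorization: let $D_k=\mathrm{diag}(\|v_k\|,\|s_{k-1}\|)$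 and $\hat H=D_k^{-1}\begin{pmatrix}\rho_1^k&\langle v_k,y^{k-1}\rangle\\ \langle v_k,y^{k-1}\rangle&\rho_2^k\end{pmatrix}D_k^{-1}$. Let $L$ be the lower triangular $2\times2$ matrix with $L_{11}=\sqrt{\hat H_{11}}$ if $\sqrt{\hat H_{11}}>c_1$ and $L_{11}=\sqrt{c_2}$ otherwise; $L_{21}=\hat H_{21}/L_{11}$; $L_{22}=\sqrt{\hat H_{22}-L_{21}^2}$ if $\hat H_{22}-L_{21}^2>c_1$ and $L_{22}=\sqrt{c_2}$ otherwise. Set $H^k=D_kLL^TD_k$. It is understood that this procedure yields matrices satisfying $$c_1\le\lambda_{\min}(D_k^{-1}H^kD_k^{-1})\le\lambda_{\max}(D_k^{-1}H^kD_k^{-1})\le c_2\quad\text{for all }k\ge1.$$ Set $\bar\alpha_i^k=\max\{\alpha_{\min},\min\{\langle s_{k-1},y_i^{k-1}\rangle/\rho_2^k,\alpha_{\max}\}\}$ if $\langle s_{k-1},y_i^{k-1}\rangle>0$; $\bar\alpha_i^k=\max\{\alpha_{\min},\min\{\|y_i^{k-1}\|/\|y^{k-1}\|,\alpha_{\max}\}\}$ if $\langle s_{k-1},y_i^{k-1}\rangle<0$; $\bar\alpha_i^k=\alpha_{\min}$ if $\langle s_{k-1},y_i^{k-1}\rangle=0$. Let $(\mu_k,\nu_k)^T\in\mathbb{R}^2$ and $\bar\lambda^k\in\Delta_m$ be the solution and a dual solution (in the same sense as in (2)) of $$\min_{(\mu,\nu)^T\in\mathbb{R}^2}\max_{i\in[m]}\left\{\mu\langle\nabla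 F_i(x^k)/\bar\alpha_i^k,v_k\rangle+\nu\langle\nabla F_i(x^k)/\bar\alpha_i^k,s_{k-1}\rangle\right\}+\frac12\left\langle\begin{pmatrix}\mu\\ \nu\end{pmatrix},H^k\begin{pmatrix}\mu\\ \nu\end{pmatrix}\right\rangle,$$ and set $d_k=\mu_kv_k+\nu_ks_{k-1}$. (5) Choose a stepsize $t=t_k>0$ satisfying the Wolfe conditions $$(F_i(x^k+td_k)-F_i(x^k))/\bar\alpha_i^k\le\sigma_1t\,\mathcal{D}_{\bar\alpha^k}(x^k,d_k)\ \ \forall i\in[m],\qquad \mathcal{D}_{\bar\alpha^k}(x^k+td_k,d_k)\ge\sigma_2\mathcal{D}_{\bar\alpha^k}(x^k,d_k),$$ and set $x^{k+1}=x^k+t_kd_k$. *)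

theory Defs
  imports "HOL-Analysis.Analysis"
begin

section \<open>Vector optimization\<close>

text \<open>The index type \<open>'m\<close> plays the role of \<open>[m]\<close>; it is finite and nonempty, so all the maxima
  below are attained.\<close>

definition grad :: "(real^'n \<Rightarrow> real^'m) \<Rightarrow> 'm \<Rightarrow> real^'n \<Rightarrow> real^'n" where
  "grad F i x = row i (jacobian F (at x))"

definition simplex_vec :: "(real^'m) set" where
  "simplex_vec = {l. (\<forall>i. 0 \<le> l $ i) \<and> (\<Sum>i\<in>UNIV. l $ i) = 1}"

definition pareto_critical :: "(real^'n \<Rightarrow> real^'m) \<Rightarrow> real^'n \<Rightarrow> bool" where
  "pareto_critical F x \<longleftrightarrow> \<not> (\<exists>d. \<forall>i. grad F i x \<bullet> d < 0)"

definition max_slope :: "(real^'n \<Rightarrow> real^'m) \<Rightarrow> real^'m \<Rightarrow> real^'n \<Rightarrow> real^'n \<Rightarrow> real" where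
  "max_slope F \<alpha> x d = (MAX i. (grad F i x /\<^sub>R (\<alpha> $ i)) \<bullet> d)"

text \<open>Extended-real valued, because the supremum need not be finite for an arbitrary \<open>F\<close>.\<close>

definition merit :: "(real^'n \<Rightarrow> real^'m) \<Rightarrow> real^'n \<Rightarrow> ereal" where
  "merit F x = (SUP y. ereal (MIN i. F x $ i - F y $ i))"

text \<open>\<open>l\<close> is a vector of KKT multipliers at \<open>p\<close> for minimizing \<open>f\<close> subject to \<open>g i \<le> 0\<close> for all \<open>i\<close>.\<close>

definition kkt_multipliers ::
  "('e::real_inner \<Rightarrow> real) \<Rightarrow> ('m::finite \<Rightarrow> 'e \<Rightarrow> real) \<Rightarrow> 'e \<Rightarrow> real^'m \<Rightarrow> bool" where
  "kkt_multipliers f g p l \<longleftrightarrow>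
     (\<forall>i. g i p \<le> 0) \<and> (\<forall>i. 0 \<le> l $ i) \<and> (\<forall>i. l $ i * g i p = 0) \<and>
     (\<exists>f' g'. (GDERIV f p :> f') \<and> (\<forall>i. GDERIV (g i) p :> g' i) \<and>
        f' + (\<Sum>i\<in>UNIV. l $ i *\<^sub>R g' i) = 0)"


section \<open>Barzilai-Borwein descent direction\<close>

definition is_BB_direction ::
  "(real^'n \<Rightarrow> real^'m) \<Rightarrow> real^'m \<Rightarrow> real^'n \<Rightarrow> real^'n \<Rightarrow> bool" where
  "is_BB_direction F \<alpha> x v \<longleftrightarrow>
     is_arg_min (\<lambda>w. MAX i. (grad F i x \<bullet> w) / \<alpha> $ i + (1/2) * (norm w)\<^sup>2) (\<lambda>_. True) v"

text \<open>Multipliers of the epigraph form: minimize \<open>\<tau> + (1/2) * (norm w)\<^sup>2\<close> over \<open>(\<tau>, w)\<close> subject to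
  \<open>(grad F i x \<bullet> w) / \<alpha> $ i \<le> \<tau>\<close>; at the solution \<open>v\<close> the optimal \<open>\<tau>\<close> is \<open>max_slope F \<alpha> x v\<close>.\<close>

definition is_BB_dual ::
  "(real^'n \<Rightarrow> real^'m) \<Rightarrow> real^'m \<Rightarrow> real^'n \<Rightarrow> real^'n \<Rightarrow> real^'m \<Rightarrow> bool" where
  "is_BB_dual F \<alpha> x v l \<longleftrightarrow> l \<in> simplex_vec \<and>
     kkt_multipliers (\<lambda>(\<tau>, w). \<tau> + (1/2) * (norm w)\<^sup>2)
       (\<lambda>i (\<tau>, w). (grad F i x \<bullet> w) / \<alpha> $ i - \<tau>)
       (max_slope F \<alpha> x v, v) l"

text \<open>The safeguarded three-way choice common to both Barzilai-Borwein parameters: \<open>sy\<close> decides the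
  case, \<open>p\<close> is used if it is positive and \<open>q\<close> if it is negative.\<close>

definition safeguard :: "real \<Rightarrow> real \<Rightarrow> real \<Rightarrow> real \<Rightarrow> real \<Rightarrow> real" where
  "safeguard \<alpha>min \<alpha>max sy p q =
     (if sy > 0 then max \<alpha>min (min p \<alpha>max)
      else if sy < 0 then max \<alpha>min (min q \<alpha>max)
      else \<alpha>min)"

definition BB_parameters ::
  "(real^'n \<Rightarrow> real^'m) \<Rightarrow> real \<Rightarrow> real \<Rightarrow> real^'n \<Rightarrow> real^'n \<Rightarrow> real^'m" where
  "BB_parameters F \<alpha>min \<alpha>max xold x =
     (\<chi> i. let s = x - xold; y = grad F i x - grad F i xold in
        safeguard \<alpha>min \<alpha>max (s \<bullet> y) ((s \<bullet> y) / (norm s)\<^sup>2) (norm y / norm s))"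


section \<open>Subspace problem\<close>

text \<open>With \<open>lb\<close>, \<open>ab\<close> the previous multipliers and parameters, \<open>y\<close> is
  \<open>weighted_diff F lb ab xold x\<close> and \<open>y\<^sub>v\<close> is \<open>weighted_diff F lb ab (x - v) x\<close>.\<close>

definition weighted_diff ::
  "(real^'n \<Rightarrow> real^'m) \<Rightarrow> real^'m \<Rightarrow> real^'m \<Rightarrow> real^'n \<Rightarrow> real^'n \<Rightarrow> real^'n" where
  "weighted_diff F lb ab xold x =
     (\<Sum>i\<in>UNIV. (lb $ i / ab $ i) *\<^sub>R (grad F i x - grad F i xold))"

definition rho1 ::
  "(real^'n \<Rightarrow> real^'m) \<Rightarrow> real^'m \<Rightarrow> real^'m \<Rightarrow> real^'n \<Rightarrow> real^'n \<Rightarrow> real" where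
  "rho1 F lb ab x v =
     (let yv = weighted_diff F lb ab (x - v) x in
      if v \<bullet> yv > 0 then v \<bullet> yv else norm v * norm yv)"

definition rho2 ::
  "(real^'n \<Rightarrow> real^'m) \<Rightarrow> real^'m \<Rightarrow> real^'m \<Rightarrow> real^'n \<Rightarrow> real^'n \<Rightarrow> real" where
  "rho2 F lb ab xold x =
     (let s = x - xold; y = weighted_diff F lb ab xold x in
      if s \<bullet> y > 0 then s \<bullet> y
      else max_slope F ab x s
             - (\<Sum>i\<in>UNIV. lb $ i * ((grad F i xold /\<^sub>R (ab $ i)) \<bullet> s)))"

text \<open>If \<open>y\<close> vanishes, the quotient in the negative case is \<open>0\<close>, so the parameter is \<open>\<alpha>min\<close>.\<close>

definition subspace_parameters ::
  "(real^'n \<Rightarrow> real^'m) \<Rightarrow> real \<Rightarrow> real \<Rightarrow> real^'m \<Rightarrow> real^'m \<Rightarrow> real^'n \<Rightarrow> real^'n \<Rightarrow> real^'m" where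
  "subspace_parameters F \<alpha>min \<alpha>max lb ab xold x =
     (\<chi> i. let s = x - xold; yi = grad F i x - grad F i xold in
        safeguard \<alpha>min \<alpha>max (s \<bullet> yi) ((s \<bullet> yi) / rho2 F lb ab xold x)
          (norm yi / norm (weighted_diff F lb ab xold x)))"

definition mat2 :: "real \<Rightarrow> real \<Rightarrow> real \<Rightarrow> real \<Rightarrow> real^2^2" where
  "mat2 a b c d = vector [vector [a, b], vector [c, d]]"

definition scaling :: "real^'n \<Rightarrow> real^'n \<Rightarrow> real^2^2" where
  "scaling v s = mat2 (norm v) 0 0 (norm s)"

definition scaled :: "real^2^2 \<Rightarrow> real^2^2 \<Rightarrow> real^2^2" where
  "scaled D A = matrix_inv D ** A ** matrix_inv D"

text \<open>The modified Cholesky factor. The test for the first pivot compares the square root with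
  \<open>c1\<close>, the test for the second one the radicand.\<close>

definition modified_cholesky :: "real \<Rightarrow> real \<Rightarrow> real^2^2 \<Rightarrow> real^2^2" where
  "modified_cholesky c1 c2 A =
     (let l11 = (if sqrt (A $ 1 $ 1) > c1 then sqrt (A $ 1 $ 1) else sqrt c2);
          l21 = A $ 2 $ 1 / l11;
          l22 = (if A $ 2 $ 2 - l21\<^sup>2 > c1 then sqrt (A $ 2 $ 2 - l21\<^sup>2) else sqrt c2)
      in mat2 l11 0 l21 l22)"

definition subspace_matrix ::
  "(real^'n \<Rightarrow> real^'m) \<Rightarrow> real \<Rightarrow> real \<Rightarrow> real^'m \<Rightarrow> real^'m \<Rightarrow> real^'n \<Rightarrow> real^'n \<Rightarrow> real^'n \<Rightarrow> real^2^2"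
where
  "subspace_matrix F c1 c2 lb ab xold x v =
     (let s = x - xold; y = weighted_diff F lb ab xold x; D = scaling v s;
          L = modified_cholesky c1 c2
                (scaled D (mat2 (rho1 F lb ab x v) (v \<bullet> y) (v \<bullet> y) (rho2 F lb ab xold x)))
      in D ** L ** transpose L ** D)"

definition is_subspace_solution ::
  "(real^'n \<Rightarrow> real^'m) \<Rightarrow> real^'m \<Rightarrow> real^'n \<Rightarrow> real^'n \<Rightarrow> real^'n \<Rightarrow> real^2^2 \<Rightarrow> real^2 \<Rightarrow> bool" where
  "is_subspace_solution F ab x v s H z \<longleftrightarrow>
     is_arg_min
       (\<lambda>w. (MAX i. w $ 1 * ((grad F i x /\<^sub>R (ab $ i)) \<bullet> v) + w $ 2 * ((grad F i x /\<^sub>R (ab $ i)) \<bullet> s))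
              + (1/2) * (w \<bullet> (H *v w)))
       (\<lambda>_. True) z"

text \<open>As in \<open>is_BB_dual\<close>, the multipliers belong to the epigraph form, here over \<open>(\<tau>, w)\<close> with
  \<open>w\<close> in the plane.\<close>

definition is_subspace_dual ::
  "(real^'n \<Rightarrow> real^'m) \<Rightarrow> real^'m \<Rightarrow> real^'n \<Rightarrow> real^'n \<Rightarrow> real^'n \<Rightarrow> real^2^2 \<Rightarrow> real^2 \<Rightarrow> real^'m \<Rightarrow> bool"
where
  "is_subspace_dual F ab x v s H z l \<longleftrightarrow> l \<in> simplex_vec \<and>
     kkt_multipliers (\<lambda>(\<tau>, w). \<tau> + (1/2) * (w \<bullet> (H *v w)))
       (\<lambda>i (\<tau>, w). w $ 1 * ((grad F i x /\<^sub>R (ab $ i)) \<bullet> v) + w $ 2 * ((grad F i x /\<^sub>R (ab $ i)) \<bullet> s) - \<tau>)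
       (max_slope F ab x (z $ 1 *\<^sub>R v + z $ 2 *\<^sub>R s), z) l"

text \<open>Extreme eigenvalues. These are meaningful only for matrices with a nonempty (real) spectrum, in
  particular symmetric ones; they are applied to the symmetric matrices \<open>scaled D H\<close> only.\<close>

definition real_eigenvalues :: "real^'n^'n \<Rightarrow> real set" where
  "real_eigenvalues A = {e. \<exists>u. u \<noteq> 0 \<and> A *v u = e *\<^sub>R u}"

definition lambda_min :: "real^'n^'n \<Rightarrow> real" where
  "lambda_min A = Min (real_eigenvalues A)"

definition lambda_max :: "real^'n^'n \<Rightarrow> real" where
  "lambda_max A = Max (real_eigenvalues A)"


section \<open>The method\<close>

definition wolfe ::
  "(real^'n \<Rightarrow> real^'m) \<Rightarrow> real \<Rightarrow> real \<Rightarrow> real^'m \<Rightarrow> real^'n \<Rightarrow> real^'n \<Rightarrow> real \<Rightarrow> bool" where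
  "wolfe F \<sigma>1 \<sigma>2 ab x d t \<longleftrightarrow>
     (\<forall>i. (F (x + t *\<^sub>R d) $ i - F x $ i) / ab $ i \<le> \<sigma>1 * t * max_slope F ab x d) \<and>
     max_slope F ab (x + t *\<^sub>R d) d \<ge> \<sigma>2 * max_slope F ab x d"

text \<open>An infinite run of the method from the starting point \<open>x 0\<close> with auxiliary point \<open>xaux\<close> (the
  iterate with index \<open>-1\<close>). The sequence \<open>z\<close> collects the solutions \<open>(\<mu>, \<nu>)\<close> of the subspace
  problems; \<open>ab\<close> and \<open>lb\<close> are the barred parameters and multipliers. The matrix \<open>H 0\<close> and the vector
  \<open>z 0\<close> are not used. That the run does not stop means \<open>v k \<noteq> 0\<close> for all \<open>k\<close>.\<close>

definition SMBBMO_run ::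
  "(real^'n \<Rightarrow> real^'m) \<Rightarrow> real \<Rightarrow> real \<Rightarrow> real \<Rightarrow> real \<Rightarrow> real \<Rightarrow> real \<Rightarrow>
   real^'n \<Rightarrow> (nat \<Rightarrow> real^'n) \<Rightarrow> (nat \<Rightarrow> real^'m) \<Rightarrow> (nat \<Rightarrow> real^'n) \<Rightarrow> (nat \<Rightarrow> real^'m) \<Rightarrow>
   (nat \<Rightarrow> real^'m) \<Rightarrow> (nat \<Rightarrow> real^'m) \<Rightarrow> (nat \<Rightarrow> real^2^2) \<Rightarrow> (nat \<Rightarrow> real^2) \<Rightarrow>
   (nat \<Rightarrow> real^'n) \<Rightarrow> (nat \<Rightarrow> real) \<Rightarrow> bool"
where
  "SMBBMO_run F c1 c2 \<sigma>1 \<sigma>2 \<alpha>min \<alpha>max xaux x \<alpha> v l ab lb H z d t \<longleftrightarrow>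
     (\<forall>k. \<alpha> k = BB_parameters F \<alpha>min \<alpha>max (case k of 0 \<Rightarrow> xaux | Suc j \<Rightarrow> x j) (x k)) \<and>
     (\<forall>k. is_BB_direction F (\<alpha> k) (x k) (v k)) \<and>
     (\<forall>k. is_BB_dual F (\<alpha> k) (x k) (v k) (l k)) \<and>
     (\<forall>k. v k \<noteq> 0) \<and>
     d 0 = v 0 \<and> lb 0 = l 0 \<and> ab 0 = \<alpha> 0 \<and>
     (\<forall>k\<ge>1. let s = x k - x (k - 1) in
        H k = subspace_matrix F c1 c2 (lb (k - 1)) (ab (k - 1)) (x (k - 1)) (x k) (v k) \<and>
        ab k = subspace_parameters F \<alpha>min \<alpha>max (lb (k - 1)) (ab (k - 1)) (x (k - 1)) (x k) \<and>
        is_subspace_solution F (ab k) (x k) (v k) s (H k) (z k) \<and>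
        is_subspace_dual F (ab k) (x k) (v k) s (H k) (z k) (lb k) \<and>
        d k = z k $ 1 *\<^sub>R v k + z k $ 2 *\<^sub>R s) \<and>
     (\<forall>k. t k > 0 \<and> wolfe F \<sigma>1 \<sigma>2 (ab k) (x k) (d k) (t k)) \<and>
     (\<forall>k. x (Suc k) = x k + t k *\<^sub>R d k)"

end

theory Submission
  imports Defs
begin

text \<open>
  All the models minimized by the method have the form \<open>M + q / 2\<close> with \<open>M\<close> positively homogeneous
  (a maximum of slopes) and \<open>q\<close> quadratic. At a minimizer \<open>z\<close> of such a function the derivative
  along the ray through \<open>z\<close> vanishes, so that \<open>M z = - q z\<close>, and comparison with the best point on any
  other ray, spanned by \<open>w\<close>, gives \<open>q z \<ge> (M w)\<^sup>2 / q w\<close>. These two facts do the work of the optimality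
  conditions.

  For the Barzilai-Borwein direction they say that the slope of \<open>v\<close> is \<open>- (norm v)\<^sup>2\<close>; replacing the
  parameters \<open>\<alpha>\<close> by others in the same interval costs at most the factor \<open>\<alpha>min / \<alpha>max\<close>. For the
  subspace problem they say that the slope of \<open>d\<close> is minus the quadratic form of \<open>H\<close> at the
  solution. Since the scaled matrix has its spectrum in \<open>[c1, c2]\<close>, this form is at least
  \<open>c1 / 2 * (norm d)\<^sup>2\<close>, and comparison with the ray through \<open>v\<close> shows that it is at least
  \<open>(\<alpha>min / \<alpha>max)\<^sup>2 / c2 * (norm v)\<^sup>2\<close> (\<open>subspace_direction_slope_bounds\<close>).

  The first bound and the Lipschitz continuity of the gradients turn the curvature condition into
  the lower bound \<open>tmin\<close> for the stepsize (\<open>wolfe_stepsize_lower_bound\<close>). With the second bound, the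
  sufficient decrease condition lets every \<open>F i\<close> fall by a fixed multiple of \<open>(norm v)\<^sup>2\<close>. The merit
  function then falls by at least the same amount, and the error bound says that this amount is at
  least \<open>r\<close> times its current value (\<open>merit_contraction\<close>).

  The scaling by \<open>diag (norm v, norm s)\<close> must be invertible, which requires \<open>s \<noteq> 0\<close>, that is, that the
  previous direction did not vanish. A vanishing combination would have slope \<open>0\<close>, and hence its
  model value would be nonnegative since \<open>H\<close> is positive semidefinite by construction; but a short step
  along \<open>v\<close> has negative model value (\<open>subspace_direction_nonzero\<close>).
\<close>

section \<open>Minimizers of a positively homogeneous function plus a quadratic form\<close>

text \<open>Along the ray through \<open>z\<close> the function is the parabola \<open>c * M z + c\<^sup>2 * q z / 2\<close>, which is minimal at
  \<open>c = 1\<close>. Comparison with \<open>c = 0\<close> and \<open>c = 2\<close> shows that \<open>q z \<ge> 0\<close>, and comparison with the vertex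
  \<open>c = - M z / q z\<close> gives the claim.\<close>

lemma homogeneous_quadratic_minimizer_value:
  fixes M q :: "'e::real_vector \<Rightarrow> real"
  assumes M: "\<And>c w. 0 \<le> c \<Longrightarrow> M (c *\<^sub>R w) = c * M w"
    and q: "\<And>c w. q (c *\<^sub>R w) = c\<^sup>2 * q w"
    and min: "\<And>w. M z + q z / 2 \<le> M w + q w / 2"
  shows "M z = - q z"
proof -
  have ray: "M z + q z / 2 \<le> c * M z + c\<^sup>2 * q z / 2" if "0 \<le> c" for c
    using min[of "c *\<^sub>R z"] M[OF that] q by simp
  have at0: "M z + q z / 2 \<le> 0"
    using ray[of 0] by simp
  have at2: "M z + q z / 2 \<le> 2 * M z + 2 * q z"
    using ray[of 2] by simp
  show ?thesis
  proof (cases "q z = 0")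
    case True
    then show ?thesis using at0 at2 by simp
  next
    case False
    then have pos: "q z > 0" using at0 at2 by linarith
    have "0 \<le> - M z / q z" using at0 pos by (simp add: field_simps)
    from ray[OF this]
    have "M z + q z / 2 \<le> - (M z)\<^sup>2 / (2 * q z)"
      using pos by (simp add: field_simps power2_eq_square)
    then have "(M z + q z / 2) * (2 * q z) \<le> - (M z)\<^sup>2"
      using pos by (simp add: field_simps)
    then have "(M z + q z)\<^sup>2 \<le> 0"
      by (simp add: power2_eq_square algebra_simps)
    then show ?thesis by simp
  qed
qed

text \<open>The minimal value is \<open>- q z / 2\<close>, and the ray through \<open>w\<close> contains a point of value at most
  \<open>- (M w)\<^sup>2 / (2 * C)\<close>.\<close>

lemma homogeneous_quadratic_minimizer_lower_bound:
  fixes M q :: "'e::real_vector \<Rightarrow> real"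
  assumes M: "\<And>c w. 0 \<le> c \<Longrightarrow> M (c *\<^sub>R w) = c * M w"
    and q: "\<And>c w. q (c *\<^sub>R w) = c\<^sup>2 * q w"
    and min: "\<And>w. M z + q z / 2 \<le> M w + q w / 2"
    and neg: "M w \<le> 0" and C: "q w \<le> C" "0 < C"
  shows "(M w)\<^sup>2 / C \<le> q z"
proof -
  \<comment> \<open>the minimizer of \<open>\<tau> * M w + \<tau>\<^sup>2 * C / 2\<close>\<close>
  define \<tau> where "\<tau> = - M w / C"
  have \<tau>: "0 \<le> \<tau>" using neg C by (simp add: \<tau>_def field_simps)
  have "M z + q z / 2 \<le> \<tau> * M w + \<tau>\<^sup>2 * q w / 2"
    using min[of "\<tau> *\<^sub>R w"] M[OF \<tau>] q by simp
  also have "\<dots> \<le> \<tau> * M w + \<tau>\<^sup>2 * C / 2"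
    using C by (simp add: mult_left_mono)
  also have "\<dots> = - ((M w)\<^sup>2 / C) / 2"
    using C by (simp add: \<tau>_def field_simps power2_eq_square)
  finally show ?thesis
    using homogeneous_quadratic_minimizer_value[OF M q min] by simp
qed

section \<open>Rayleigh quotients of symmetric matrices\<close>

text \<open>Otherwise the form would become negative after a small step from \<open>u\<close> against its gradient direction
  \<open>B *v u\<close>.\<close>

lemma psd_form_zero_imp_kernel:
  fixes B :: "real^'n^'n"
  assumes sym: "transpose B = B" and psd: "\<And>w. 0 \<le> w \<bullet> (B *v w)"
    and u: "u \<bullet> (B *v u) = 0"
  shows "B *v u = 0"
proof (rule ccontr)
  define g where "g = B *v u"
  define b where "b = g \<bullet> (B *v g)"
  assume "B *v u \<noteq> 0"
  then have gg: "0 < g \<bullet> g" by (simp add: g_def)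
  have ug: "u \<bullet> (B *v g) = g \<bullet> g"
    using dot_lmul_matrix[of u B g] sym
    by (metis g_def transpose_matrix_vector)
  have b: "0 \<le> b" using psd by (simp add: b_def)
  define e where "e = (g \<bullet> g) / (b + 1)"
  have e: "0 < e" using gg b by (simp add: e_def)
  have "0 \<le> (u - e *\<^sub>R g) \<bullet> (B *v (u - e *\<^sub>R g))" by (rule psd)
  also have "\<dots> = e * (e * b - 2 * (g \<bullet> g))"
    using u ug by (simp add: matrix_vector_mult_diff_distrib matrix_vector_mult_scaleR inner_diff_left
        inner_diff_right b_def algebra_simps flip: g_def)
  finally have "2 * (g \<bullet> g) \<le> e * b" using e by (simp add: zero_le_mult_iff)
  moreover have "e * b \<le> e * (b + 1)" using e by simp
  moreover have "e * (b + 1) = g \<bullet> g" using b by (simp add: e_def)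
  ultimately show False using gg by linarith
qed

text \<open>Eigenvectors of a symmetric matrix for distinct eigenvalues are orthogonal, hence independent. The
  finiteness is what gives \<open>Min\<close> and \<open>Max\<close> of the spectrum their meaning.\<close>

lemma finite_real_eigenvalues_symmetric:
  fixes A :: "real^'n^'n"
  assumes sym: "transpose A = A"
  shows "finite (real_eigenvalues A)"
proof -
  have "\<forall>e\<in>real_eigenvalues A. \<exists>u. u \<noteq> 0 \<and> A *v u = e *\<^sub>R u"
    by (simp add: real_eigenvalues_def)
  then obtain f where f: "\<And>e. e \<in> real_eigenvalues A \<Longrightarrow> f e \<noteq> 0"
      "\<And>e. e \<in> real_eigenvalues A \<Longrightarrow> A *v f e = e *\<^sub>R f e"
    by metis
  have orth: "f a \<bullet> f b = 0"
    if ab: "a \<in> real_eigenvalues A" "b \<in> real_eigenvalues A" "a \<noteq> b" for a b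
  proof -
    have "f a \<bullet> (A *v f b) = (A *v f a) \<bullet> f b"
      using dot_lmul_matrix[of "f a" A "f b"] sym by (metis transpose_matrix_vector)
    then have "b * (f a \<bullet> f b) = a * (f a \<bullet> f b)"
      using f(2) ab by simp
    then show ?thesis using ab by simp
  qed
  have inj: "inj_on f (real_eigenvalues A)"
    using orth f(1) by (metis inj_onI inner_eq_zero_iff)
  have "pairwise orthogonal (f ` real_eigenvalues A)"
    using orth by (auto simp: pairwise_def orthogonal_def)
  moreover have "0 \<notin> f ` real_eigenvalues A" using f(1) by force
  ultimately have "finite (f ` real_eigenvalues A)"
    using pairwise_orthogonal_independent independent_imp_finite by blast
  then show ?thesis using inj finite_imageD by blast
qed

text \<open>The maximum \<open>m\<close> of the form on the unit sphere is attained at some \<open>u\<close>. Then \<open>m *\<^sub>R mat 1 - A\<close> is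
  positive semidefinite and its form vanishes at \<open>u\<close>, so that \<open>u\<close> is an eigenvector for \<open>m\<close>.\<close>

lemma symmetric_has_dominating_eigenvalue:
  fixes A :: "real^'n^'n"
  assumes sym: "transpose A = A"
  obtains m where "m \<in> real_eigenvalues A" "\<And>w. w \<bullet> (A *v w) \<le> m * (norm w)\<^sup>2"
proof -
  have "compact (sphere (0::real^'n) 1)" by simp
  moreover have "sphere (0::real^'n) 1 \<noteq> {}" by simp
  moreover have "continuous_on (sphere 0 1) (\<lambda>w. w \<bullet> (A *v w))"
    by (intro continuous_intros linear_continuous_on matrix_vector_mul_bounded_linear)
  ultimately obtain u where u: "norm u = 1" "\<And>w. norm w = 1 \<Longrightarrow> w \<bullet> (A *v w) \<le> u \<bullet> (A *v u)"
    using continuous_attains_sup[of "sphere (0::real^'n) 1" "\<lambda>w. w \<bullet> (A *v w)"] by auto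
  define m where "m = u \<bullet> (A *v u)"
  have le: "w \<bullet> (A *v w) \<le> m * (norm w)\<^sup>2" for w
  proof (cases "w = 0")
    case False
    have "sgn w \<bullet> (A *v sgn w) \<le> m"
      unfolding m_def by (rule u(2)) (simp add: norm_sgn False)
    moreover have "sgn w \<bullet> (A *v sgn w) = (w \<bullet> (A *v w)) / (norm w)\<^sup>2"
      by (simp add: sgn_div_norm matrix_vector_mult_scaleR power2_eq_square field_simps)
    ultimately show ?thesis using False by (simp add: field_simps)
  qed simp
  define B where "B = m *\<^sub>R mat 1 - A"
  have Bv: "B *v w = m *\<^sub>R w - A *v w" for w
    by (simp add: B_def matrix_vector_mult_diff_rdistrib scaleR_matrix_vector_assoc[symmetric])
  have "B *v u = 0"
  proof (rule psd_form_zero_imp_kernel)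
    show "transpose B = B"
      using sym by (simp add: B_def transpose_def vec_eq_iff mat_def)
    show "0 \<le> w \<bullet> (B *v w)" for w
      using le[of w] by (simp add: Bv inner_diff_right power2_norm_eq_inner)
    show "u \<bullet> (B *v u) = 0"
      using u(1) by (simp add: Bv inner_diff_right m_def flip: power2_norm_eq_inner)
  qed
  then have "A *v u = m *\<^sub>R u" by (simp add: Bv)
  moreover have "u \<noteq> 0" using u(1) by auto
  ultimately have "m \<in> real_eigenvalues A" by (auto simp: real_eigenvalues_def)
  then show ?thesis using that le by blast
qed

lemma lambda_max_rayleigh:
  fixes A :: "real^'n^'n"
  assumes sym: "transpose A = A"
  shows "w \<bullet> (A *v w) \<le> lambda_max A * (norm w)\<^sup>2"
proof -
  obtain m where m: "m \<in> real_eigenvalues A" "w \<bullet> (A *v w) \<le> m * (norm w)\<^sup>2"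
    using symmetric_has_dominating_eigenvalue[OF sym] by metis
  then have "m \<le> lambda_max A"
    using finite_real_eigenvalues_symmetric[OF sym] by (simp add: lambda_max_def)
  then show ?thesis using m(2) by (meson mult_right_mono order_trans zero_le_power2)
qed

lemma lambda_min_rayleigh:
  fixes A :: "real^'n^'n"
  assumes sym: "transpose A = A"
  shows "lambda_min A * (norm w)\<^sup>2 \<le> w \<bullet> (A *v w)"
proof -
  have neg: "(- A) *v u = - (A *v u)" for u
    by (simp add: vec_eq_iff matrix_vector_mult_def sum_negf)
  have "transpose (- A) = - A"
    using sym by (simp add: transpose_def vec_eq_iff)
  then obtain m where m: "m \<in> real_eigenvalues (- A)" "w \<bullet> ((- A) *v w) \<le> m * (norm w)\<^sup>2"
    using symmetric_has_dominating_eigenvalue by metis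
  have "- m \<in> real_eigenvalues A"
    using m(1) unfolding real_eigenvalues_def neg by (auto simp: minus_equation_iff[of "A *v _"])
  then have "lambda_min A \<le> - m"
    using finite_real_eigenvalues_symmetric[OF sym] by (simp add: lambda_min_def)
  then have "lambda_min A * (norm w)\<^sup>2 \<le> - m * (norm w)\<^sup>2" by (rule mult_right_mono) simp
  also have "\<dots> \<le> w \<bullet> (A *v w)" using m(2) by (simp add: neg)
  finally show ?thesis .
qed

section \<open>Slopes\<close>

lemma max_slope_ge: "(grad F i p /\<^sub>R (a $ i)) \<bullet> d \<le> max_slope F a p d"
  unfolding max_slope_def by (rule Max_ge) auto

lemma max_slope_le_iff: "max_slope F a p d \<le> B \<longleftrightarrow> (\<forall>i. (grad F i p /\<^sub>R (a $ i)) \<bullet> d \<le> B)"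
  unfolding max_slope_def by (subst Max_le_iff) auto

lemma max_slope_scaleR:
  assumes "0 \<le> c"
  shows "max_slope F a p (c *\<^sub>R d) = c * max_slope F a p d"
proof -
  have "mono (\<lambda>u::real. c * u)" using assms by (simp add: mono_def mult_left_mono)
  from mono_Max_commute[OF this, of "range (\<lambda>i. (grad F i p /\<^sub>R (a $ i)) \<bullet> d)"]
  show ?thesis by (simp add: max_slope_def image_image)
qed

lemma is_BB_direction_minimizes:
  assumes "is_BB_direction F a p v"
  shows "max_slope F a p v + (norm v)\<^sup>2 / 2 \<le> max_slope F a p w + (norm w)\<^sup>2 / 2"
proof -
  have g: "(grad F i p \<bullet> w) / a $ i = (grad F i p /\<^sub>R (a $ i)) \<bullet> w" for i w
    by (simp add: divide_inverse_commute)
  have eq: "(MAX i. (grad F i p \<bullet> w) / a $ i + (1/2) * (norm w)\<^sup>2)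
      = max_slope F a p w + (1/2) * (norm w)\<^sup>2" for w
    unfolding g max_slope_def by (rule Max_add_commute) simp_all
  show ?thesis
    using assms unfolding is_BB_direction_def is_arg_min_linorder eq by simp
qed

lemma is_BB_direction_slope:
  assumes "is_BB_direction F a p v"
  shows "max_slope F a p v = - (norm v)\<^sup>2"
  by (rule homogeneous_quadratic_minimizer_value)
    (simp_all add: max_slope_scaleR power_mult_distrib is_BB_direction_minimizes[OF assms])

text \<open>Each directional derivative is at most \<open>- (a $ i * B)\<close>, so that its quotient by \<open>b $ i\<close> is at most
  \<open>- (a $ i / b $ i * B)\<close>, and \<open>a $ i / b $ i \<ge> lo / hi\<close>.\<close>

lemma max_slope_change_parameters:
  assumes slope: "max_slope F a p v \<le> - B" and B: "0 \<le> B"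
    and lo: "0 < lo" "\<And>i. lo \<le> a $ i"
    and b: "\<And>i. 0 < b $ i" "\<And>i. b $ i \<le> hi"
  shows "max_slope F b p v \<le> - (lo / hi * B)"
  unfolding max_slope_le_iff
proof
  fix i
  have a: "0 < a $ i" using lo by (meson less_le_trans)
  have "(grad F i p \<bullet> v) / a $ i \<le> - B"
    using slope unfolding max_slope_le_iff by (simp add: divide_inverse mult.commute)
  then have g: "grad F i p \<bullet> v \<le> - (a $ i * B)" using a by (simp add: field_simps)
  have hi: "0 < hi" using b by (meson less_le_trans)
  have "lo / hi * B \<le> a $ i / b $ i * B"
    using lo b a B by (intro mult_right_mono frac_le) auto
  also have "\<dots> \<le> - (grad F i p \<bullet> v) / b $ i"
    using g b(1)[of i] by (simp add: field_simps)
  finally show "(grad F i p /\<^sub>R (b $ i)) \<bullet> v \<le> - (lo / hi * B)"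
    by (simp add: divide_inverse mult.commute)
qed

lemma safeguard_bounds:
  assumes "lo \<le> hi"
  shows "lo \<le> safeguard lo hi sy p q" "safeguard lo hi sy p q \<le> hi"
  using assms by (auto simp: safeguard_def)

lemma max_slope_lipschitz:
  assumes lip: "\<And>i. (L i)-lipschitz_on UNIV (grad F i)"
    and lo: "0 < lo" "\<And>i. lo \<le> b $ i" and t: "0 \<le> t"
  shows "max_slope F b (p + t *\<^sub>R d) d \<le> max_slope F b p d + (MAX i. L i) / lo * t * (norm d)\<^sup>2"
  unfolding max_slope_le_iff
proof
  fix i
  have b: "0 < b $ i" using lo by (meson less_le_trans)
  have L: "L i \<le> (MAX i. L i)" by (rule Max_ge) auto
  have L0: "0 \<le> L i" using lip lipschitz_on_nonneg by blast
  have "(grad F i (p + t *\<^sub>R d) - grad F i p) \<bullet> d \<le> norm (grad F i (p + t *\<^sub>R d) - grad F i p) * norm d"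
    by (rule norm_cauchy_schwarz)
  also have "\<dots> \<le> (L i * (t * norm d)) * norm d"
    using lipschitz_onD[OF lip, of "p + t *\<^sub>R d" p i] t by (intro mult_right_mono) (auto simp: dist_norm)
  finally have "(grad F i (p + t *\<^sub>R d) - grad F i p) \<bullet> d \<le> L i * (t * (norm d)\<^sup>2)"
    by (simp add: power2_eq_square mult.assoc)
  then have "((grad F i (p + t *\<^sub>R d) - grad F i p) \<bullet> d) / b $ i \<le> L i * (t * (norm d)\<^sup>2) / b $ i"
    using b by (simp add: divide_right_mono)
  also have "\<dots> \<le> (MAX i. L i) * (t * (norm d)\<^sup>2) / lo"
    using L L0 lo t order_trans[OF L0 L] by (intro frac_le mult_right_mono mult_nonneg_nonneg) auto
  finally have "((grad F i (p + t *\<^sub>R d) - grad F i p) \<bullet> d) / b $ i \<le> (MAX i. L i) / lo * t * (norm d)\<^sup>2"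
    by simp
  moreover have "(grad F i p /\<^sub>R (b $ i)) \<bullet> d \<le> max_slope F b p d" by (rule max_slope_ge)
  ultimately show "(grad F i (p + t *\<^sub>R d) /\<^sub>R (b $ i)) \<bullet> d
      \<le> max_slope F b p d + (MAX i. L i) / lo * t * (norm d)\<^sup>2"
    by (simp add: inner_diff_left divide_inverse algebra_simps)
qed

section \<open>The merit function along a Wolfe step\<close>

text \<open>The curvature condition makes the slope grow by at least \<open>(1 - \<sigma>2) * \<gamma> * (norm d)\<^sup>2\<close> along the step,
  while it grows by at most \<open>(MAX i. L i) / lo * t * (norm d)\<^sup>2\<close>. If all Lipschitz constants are \<open>0\<close>,
  then the bound is \<open>0\<close> by the convention on division.\<close>

lemma wolfe_stepsize_lower_bound:
  assumes lip: "\<And>i. (L i)-lipschitz_on UNIV (grad F i)"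
    and lo: "0 < lo" "\<And>i. lo \<le> b $ i"
    and wolfe: "wolfe F \<sigma>1 \<sigma>2 b p d t" "0 < t" "\<sigma>2 < 1"
    and slope: "\<gamma> * (norm d)\<^sup>2 \<le> - max_slope F b p d" "d \<noteq> 0"
  shows "(1 - \<sigma>2) * \<gamma> * lo / (MAX i. L i) \<le> t"
proof -
  define m where "m = (MAX i. L i)"
  have "0 \<le> L i" for i using lip lipschitz_on_nonneg by blast
  moreover have "L i \<le> m" for i unfolding m_def by (rule Max_ge) auto
  ultimately have m: "0 \<le> m" by (meson order_trans)
  have "(1 - \<sigma>2) * (\<gamma> * (norm d)\<^sup>2) \<le> (1 - \<sigma>2) * - max_slope F b p d"
    using slope wolfe by (intro mult_left_mono) auto
  also have "\<dots> \<le> max_slope F b (p + t *\<^sub>R d) d - max_slope F b p d"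
    using wolfe by (simp add: wolfe_def algebra_simps)
  also have "\<dots> \<le> m / lo * t * (norm d)\<^sup>2"
    using max_slope_lipschitz[OF lip lo, of t p d] wolfe by (simp add: m_def)
  finally have "((1 - \<sigma>2) * \<gamma>) * (norm d)\<^sup>2 \<le> (m / lo * t) * (norm d)\<^sup>2" by (simp add: mult_ac)
  then have "(1 - \<sigma>2) * \<gamma> \<le> m / lo * t"
    by (rule mult_right_le_imp_le) (use slope(2) in simp)
  then have "(1 - \<sigma>2) * \<gamma> * lo \<le> m * t" using lo by (simp add: field_simps)
  then show ?thesis
    using m wolfe by (cases "m = 0") (auto simp: field_simps simp flip: m_def)
qed

lemma merit_nonneg: "0 \<le> merit F p"
  unfolding merit_def by (rule SUP_upper2[of p]) simp_all

text \<open>A common decrease of all components of \<open>F\<close> passes through the minimum and the supremum to \<open>merit\<close>.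
  The upper bound makes the merit value at \<open>p\<close> finite and turns the decrease \<open>r * B\<close> into at least
  \<open>r\<close> times that value.\<close>

lemma merit_contraction:
  assumes bound: "merit F p \<le> ereal B" and r: "0 \<le> r"
    and decrease: "\<And>i. F q $ i \<le> F p $ i - r * B"
  shows "merit F q \<le> ereal (1 - r) * merit F p"
proof -
  obtain M where M: "merit F p = ereal M"
    using merit_nonneg[of F p] bound by (cases "merit F p") auto
  have "merit F q \<le> ereal (M - r * B)"
    unfolding merit_def
  proof (rule SUP_least)
    fix y
    have "(MIN i. F q $ i - F y $ i) \<le> (MIN i. F p $ i - F y $ i) - r * B"
    proof -
      obtain j where j: "(MIN i. F p $ i - F y $ i) = F p $ j - F y $ j"
        using Min_in[of "range (\<lambda>i. F p $ i - F y $ i)"]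
        by (auto simp: image_iff)
      have "(MIN i. F q $ i - F y $ i) \<le> F q $ j - F y $ j" by (rule Min_le) auto
      then show ?thesis unfolding j using decrease[of j] by linarith
    qed
    moreover have "(MIN i. F p $ i - F y $ i) \<le> M"
      using SUP_upper[of y UNIV "\<lambda>y. ereal (MIN i. F p $ i - F y $ i)"] M by (simp add: merit_def)
    ultimately show "ereal (MIN i. F q $ i - F y $ i) \<le> ereal (M - r * B)" by simp
  qed
  also have "\<dots> \<le> ereal ((1 - r) * M)"
    using bound r by (simp add: M algebra_simps mult_right_mono)
  finally show ?thesis by (simp add: M)
qed

text \<open>Here \<open>N\<close> is the squared length of the Barzilai-Borwein direction, \<open>\<gamma>\<close> measures the descent against the
  length of \<open>d\<close>, which controls the stepsize, and \<open>\<eta>\<close> measures it against \<open>N\<close>, which enters the error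
  bound. The rate depends on their product only.\<close>

lemma merit_contraction_wolfe:
  assumes lip: "\<And>i. (L i)-lipschitz_on UNIV (grad F i)"
    and lo: "0 < lo" "\<And>i. lo \<le> b $ i"
    and wolfe: "wolfe F \<sigma>1 \<sigma>2 b p d t" "0 < t" "0 < \<sigma>1" "\<sigma>2 < 1"
    and slope: "\<gamma> * (norm d)\<^sup>2 \<le> - max_slope F b p d" "\<eta> * N \<le> - max_slope F b p d"
    and pos: "0 \<le> \<gamma>" "0 \<le> \<eta>" "0 \<le> N" "0 < \<kappa>" "d \<noteq> 0"
    and bound: "merit F p \<le> ereal (\<kappa> * N)"
    and r: "0 \<le> r" "r \<le> \<sigma>1 * ((1 - \<sigma>2) * \<gamma> * lo / (MAX i. L i)) * lo * \<eta> / \<kappa>"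
  shows "merit F (p + t *\<^sub>R d) \<le> ereal (1 - r) * merit F p"
proof (rule merit_contraction[OF bound r(1)])
  fix i
  have b: "0 < b $ i" using lo by (meson less_le_trans)
  have t: "(1 - \<sigma>2) * \<gamma> * lo / (MAX i. L i) \<le> t"
    using lip lo wolfe slope pos by (intro wolfe_stepsize_lower_bound) auto
  \<comment> \<open>the sufficient decrease condition is divided by \<open>b $ i\<close>, which costs the factor \<open>lo\<close>\<close>
  have "r * (\<kappa> * N) \<le> \<sigma>1 * ((1 - \<sigma>2) * \<gamma> * lo / (MAX i. L i)) * lo * \<eta> / \<kappa> * (\<kappa> * N)"
    using r pos by (intro mult_right_mono) auto
  also have "\<dots> = ((1 - \<sigma>2) * \<gamma> * lo / (MAX i. L i)) * (\<sigma>1 * lo * (\<eta> * N))"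
    using pos by simp
  also have "\<dots> \<le> t * (\<sigma>1 * lo * (\<eta> * N))"
    using t wolfe lo pos by (intro mult_right_mono) auto
  also have "\<dots> = \<sigma>1 * t * (\<eta> * N) * lo" by simp
  also have "\<dots> \<le> \<sigma>1 * t * (- max_slope F b p d) * lo"
    using slope wolfe lo by (intro mult_right_mono mult_left_mono) auto
  also have "\<dots> \<le> \<sigma>1 * t * (- max_slope F b p d) * b $ i"
  proof (rule mult_left_mono[OF lo(2)])
    have "0 \<le> \<eta> * N" using pos by simp
    then show "0 \<le> \<sigma>1 * t * (- max_slope F b p d)" using slope wolfe
      by (intro mult_nonneg_nonneg) linarith+
  qed
  also have "\<dots> \<le> F p $ i - F (p + t *\<^sub>R d) $ i"
  proof -
    have "(F (p + t *\<^sub>R d) $ i - F p $ i) / b $ i \<le> \<sigma>1 * t * max_slope F b p d"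
      using wolfe by (simp add: wolfe_def)
    then show ?thesis using b by (simp add: field_simps)
  qed
  finally show "F (p + t *\<^sub>R d) $ i \<le> F p $ i - r * (\<kappa> * N)" by simp
qed

section \<open>The subspace direction\<close>

lemma scaling_mult_vec: "scaling v s *v w = vector [norm v * w $ 1, norm s * w $ 2]"
  by (simp add: scaling_def mat2_def vec_eq_iff forall_2 matrix_vector_mult_def sum_2)

lemma norm_scaling_mult_vec:
  "(norm (scaling v s *v w))\<^sup>2 = (norm v * w $ 1)\<^sup>2 + (norm s * w $ 2)\<^sup>2"
  unfolding power2_norm_eq_inner scaling_mult_vec by (simp add: inner_vec_def sum_2 power2_eq_square)

lemma transpose_scaling: "transpose (scaling v s) = scaling v s"
  by (simp add: scaling_def mat2_def vec_eq_iff forall_2 transpose_def)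

lemma invertible_scaling: "v \<noteq> 0 \<Longrightarrow> s \<noteq> 0 \<Longrightarrow> invertible (scaling v s)"
  by (simp add: invertible_det_nz det_2 scaling_def mat2_def)

text \<open>The factor \<open>2\<close> comes from \<open>(a + b)\<^sup>2 \<le> 2 * (a\<^sup>2 + b\<^sup>2)\<close> and is the \<open>2\<close> in the denominator of \<open>tmin\<close>.\<close>

lemma norm_combination_le_scaling:
  "(norm (z $ 1 *\<^sub>R v + z $ 2 *\<^sub>R s))\<^sup>2 \<le> 2 * (norm (scaling v s *v z))\<^sup>2"
proof -
  have n: "(norm (scaling v s *v z))\<^sup>2 = (norm v * z $ 1)\<^sup>2 + (norm s * z $ 2)\<^sup>2"
    by (simp add: norm_scaling_mult_vec power_mult_distrib)
  have "norm (z $ 1 *\<^sub>R v + z $ 2 *\<^sub>R s) \<le> \<bar>norm v * z $ 1\<bar> + \<bar>norm s * z $ 2\<bar>"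
    by (rule norm_triangle_le) (simp add: abs_mult mult.commute)
  then have "(norm (z $ 1 *\<^sub>R v + z $ 2 *\<^sub>R s))\<^sup>2 \<le> (\<bar>norm v * z $ 1\<bar> + \<bar>norm s * z $ 2\<bar>)\<^sup>2"
    by (intro power_mono) auto
  also have "\<dots> \<le> 2 * ((norm v * z $ 1)\<^sup>2 + (norm s * z $ 2)\<^sup>2)"
    using sum_squares_bound[of "\<bar>norm v * z $ 1\<bar>" "\<bar>norm s * z $ 2\<bar>"]
    by (simp add: power2_sum)
  finally show ?thesis by (simp add: n)
qed

lemma matrix_form_congruence:
  fixes D C :: "real^'n^'n"
  assumes "transpose D = D"
  shows "w \<bullet> ((D ** C ** D) *v w) = (D *v w) \<bullet> (C *v (D *v w))"
  using assms dot_lmul_matrix[of w D "C *v (D *v w)"]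
  by (metis matrix_vector_mul_assoc transpose_matrix_vector)

lemma scaled_congruence:
  assumes "invertible D"
  shows "scaled D (D ** C ** D) = C"
proof -
  have inv: "D ** matrix_inv D = mat 1" "matrix_inv D ** D = mat 1"
    using someI_ex[OF assms[unfolded invertible_def]] by (simp_all add: matrix_inv_def)
  have "scaled D (D ** C ** D) = (matrix_inv D ** D) ** C ** (D ** matrix_inv D)"
    by (simp add: scaled_def matrix_mul_assoc)
  then show ?thesis by (simp add: inv)
qed

lemma gram_form_nonneg: "0 \<le> w \<bullet> (((L::real^'n^'n) ** transpose L) *v w)"
proof -
  have "w \<bullet> ((L ** transpose L) *v w) = (transpose L *v w) \<bullet> (transpose L *v w)"
    using dot_lmul_matrix[of w L "transpose L *v w"]
    by (simp flip: matrix_vector_mul_assoc)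
  then show ?thesis by simp
qed

lemma is_subspace_solution_minimizes:
  assumes "is_subspace_solution F b p v s H z"
  shows "max_slope F b p (z $ 1 *\<^sub>R v + z $ 2 *\<^sub>R s) + (z \<bullet> (H *v z)) / 2
       \<le> max_slope F b p (w $ 1 *\<^sub>R v + w $ 2 *\<^sub>R s) + (w \<bullet> (H *v w)) / 2"
  using assms
  by (simp add: is_subspace_solution_def is_arg_min_linorder max_slope_def inner_add_right)

lemma subspace_combination_scaleR:
  "(c *\<^sub>R w) $ 1 *\<^sub>R v + (c *\<^sub>R w) $ 2 *\<^sub>R s = c *\<^sub>R (w $ 1 *\<^sub>R (v::'e::real_vector) + (w::real^2) $ 2 *\<^sub>R s)"
  by (simp add: scaleR_right_distrib)

lemma matrix_form_scaleR: "(c *\<^sub>R w) \<bullet> (H *v (c *\<^sub>R w)) = c\<^sup>2 * (w \<bullet> ((H::real^'n^'n) *v w))"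
  by (simp add: matrix_vector_mult_scaleR power2_eq_square)

lemma subspace_solution_slope:
  assumes "is_subspace_solution F b p v s H z"
  shows "max_slope F b p (z $ 1 *\<^sub>R v + z $ 2 *\<^sub>R s) = - (z \<bullet> (H *v z))"
  by (rule homogeneous_quadratic_minimizer_value[where M = "\<lambda>w. max_slope F b p (w $ 1 *\<^sub>R v + w $ 2 *\<^sub>R s)"])
    (use is_subspace_solution_minimizes[OF assms]
      in \<open>simp_all only: subspace_combination_scaleR max_slope_scaleR matrix_form_scaleR\<close>)

text \<open>The comparison ray is the one through \<open>axis 1 1\<close>, which represents \<open>v\<close>.\<close>

lemma subspace_solution_form_lower_bound:
  assumes sol: "is_subspace_solution F b p v s H z"
    and neg: "max_slope F b p v \<le> 0" and C: "H $ 1 $ 1 \<le> C" "0 < C"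
  shows "(max_slope F b p v)\<^sup>2 / C \<le> z \<bullet> (H *v z)"
proof -
  define M where "M w = max_slope F b p (w $ 1 *\<^sub>R v + w $ 2 *\<^sub>R s)" for w :: "real^2"
  have e: "M (axis 1 1) = max_slope F b p v"
    by (simp add: M_def axis_def)
  have "axis 1 1 \<bullet> (H *v axis 1 1) = H $ 1 $ 1"
    by (simp add: inner_axis' matrix_vector_mult_basis column_def)
  then have "(M (axis 1 1))\<^sup>2 / C \<le> z \<bullet> (H *v z)"
    using is_subspace_solution_minimizes[OF sol] neg C e
    by (intro homogeneous_quadratic_minimizer_lower_bound[where q = "\<lambda>w. w \<bullet> (H *v w)"])
      (simp_all only: M_def subspace_combination_scaleR max_slope_scaleR matrix_form_scaleR)
  then show ?thesis by (simp add: e)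
qed

text \<open>When \<open>v\<close> and \<open>s\<close> are linearly dependent, a nonzero \<open>z\<close> could represent the zero vector, so that \<open>z \<noteq> 0\<close>
  alone would not suffice. A vanishing direction has slope \<open>0\<close>, hence the form of \<open>H\<close> vanishes at \<open>z\<close>,
  which contradicts the lower bound for it.\<close>

lemma subspace_direction_nonzero:
  assumes sol: "is_subspace_solution F b p v s H z"
    and neg: "max_slope F b p v < 0" and psd: "\<And>w. 0 \<le> w \<bullet> (H *v w)"
  shows "z $ 1 *\<^sub>R v + z $ 2 *\<^sub>R s \<noteq> 0"
proof
  assume d: "z $ 1 *\<^sub>R v + z $ 2 *\<^sub>R s = 0"
  have "(max_slope F b p v)\<^sup>2 / (\<bar>H $ 1 $ 1\<bar> + 1) \<le> z \<bullet> (H *v z)"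
    using sol neg by (intro subspace_solution_form_lower_bound) auto
  moreover have "0 < (max_slope F b p v)\<^sup>2 / (\<bar>H $ 1 $ 1\<bar> + 1)" using neg by simp
  moreover have "z \<bullet> (H *v z) = 0"
    using subspace_solution_slope[OF sol] max_slope_scaleR[of 0 F b p 0] d by simp
  ultimately show False by simp
qed

text \<open>Up to the change of variables \<open>scaling v s\<close> the form of \<open>H\<close> is that of the scaled matrix, to which the
  eigenvalue bounds apply: from below at the solution, and from above on the axis that represents
  \<open>v\<close>, where \<open>scaling v s\<close> acts as multiplication by \<open>norm v\<close>.\<close>

lemma subspace_direction_slope_bounds:
  assumes sol: "is_subspace_solution F b p v s H z"
    and H: "H = scaling v s ** C ** scaling v s" and sym: "transpose C = C"
    and nz: "v \<noteq> 0" "s \<noteq> 0"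
    and c: "0 < c1" "c1 \<le> lambda_min (scaled (scaling v s) H)"
      "lambda_max (scaled (scaling v s) H) \<le> c2" "0 < c2"
    and slope: "max_slope F b p v \<le> - (\<rho> * (norm v)\<^sup>2)" "0 \<le> \<rho>"
  defines "d \<equiv> z $ 1 *\<^sub>R v + z $ 2 *\<^sub>R s"
  shows "c1 / 2 * (norm d)\<^sup>2 \<le> - max_slope F b p d"
    and "\<rho>\<^sup>2 / c2 * (norm v)\<^sup>2 \<le> - max_slope F b p d"
proof -
  define D where "D = scaling v s"
  have form: "w \<bullet> (H *v w) = (D *v w) \<bullet> (C *v (D *v w))" for w
    unfolding H D_def by (rule matrix_form_congruence) (rule transpose_scaling)
  have C: "scaled D H = C"
    unfolding H D_def by (rule scaled_congruence) (rule invertible_scaling[OF nz])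
  have eq: "- max_slope F b p d = z \<bullet> (H *v z)"
    using subspace_solution_slope[OF sol] by (simp add: d_def)
  have "c1 / 2 * (norm d)\<^sup>2 \<le> c1 / 2 * (2 * (norm (D *v z))\<^sup>2)"
    unfolding d_def D_def using c by (intro mult_left_mono norm_combination_le_scaling) auto
  also have "\<dots> \<le> lambda_min C * (norm (D *v z))\<^sup>2"
    using c C by (simp add: D_def mult_right_mono)
  also have "\<dots> \<le> (D *v z) \<bullet> (C *v (D *v z))"
    by (rule lambda_min_rayleigh[OF sym])
  finally show "c1 / 2 * (norm d)\<^sup>2 \<le> - max_slope F b p d"
    by (simp add: eq form)
  have "H $ 1 $ 1 = axis 1 1 \<bullet> (H *v axis 1 1)"
    by (simp add: inner_axis' matrix_vector_mult_basis column_def)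
  also have "\<dots> \<le> lambda_max C * (norm (D *v axis 1 1))\<^sup>2"
    unfolding form by (rule lambda_max_rayleigh[OF sym])
  also have "\<dots> \<le> c2 * (norm (D *v axis 1 1))\<^sup>2"
    using c C by (intro mult_right_mono) (auto simp: D_def)
  also have "(norm (D *v axis 1 1))\<^sup>2 = (norm v)\<^sup>2"
    by (simp add: D_def norm_scaling_mult_vec axis_def)
  finally have H11: "H $ 1 $ 1 \<le> c2 * (norm v)\<^sup>2" .
  have "\<rho>\<^sup>2 / c2 * (norm v)\<^sup>2 = (\<rho> * (norm v)\<^sup>2)\<^sup>2 / (c2 * (norm v)\<^sup>2)"
    using nz c by (simp add: power2_eq_square)
  also have "\<dots> \<le> (max_slope F b p v)\<^sup>2 / (c2 * (norm v)\<^sup>2)"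
  proof (rule divide_right_mono)
    have "(\<rho> * (norm v)\<^sup>2)\<^sup>2 \<le> (- max_slope F b p v)\<^sup>2"
      using slope by (intro power_mono) auto
    then show "(\<rho> * (norm v)\<^sup>2)\<^sup>2 \<le> (max_slope F b p v)\<^sup>2" by simp
  qed (use c in simp)
  also have "\<dots> \<le> z \<bullet> (H *v z)"
  proof (rule subspace_solution_form_lower_bound[OF sol _ H11])
    have "0 \<le> \<rho> * (norm v)\<^sup>2" using slope by simp
    then show "max_slope F b p v \<le> 0" using slope by linarith
  qed (use nz c in simp)
  finally show "\<rho>\<^sup>2 / c2 * (norm v)\<^sup>2 \<le> - max_slope F b p d"
    by (simp add: eq)
qed

text \<open>Whatever pivots the modified factorization chooses, the matrix is congruent to a Gram matrix. Hence
  it is positive semidefinite, and the scaled matrix is symmetric.\<close>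

lemma subspace_matrix_eq_congruence:
  "\<exists>L::real^2^2. subspace_matrix F c1 c2 lb ab xold x v
     = scaling v (x - xold) ** (L ** transpose L) ** scaling v (x - xold)"
  unfolding subspace_matrix_def Let_def matrix_mul_assoc by (rule exI, rule refl)

section \<open>Linear convergence\<close>

theorem theorem4p2:
  fixes F :: "real^'n \<Rightarrow> real^'m"
    and L :: "'m \<Rightarrow> real"
    and c1 c2 \<sigma>1 \<sigma>2 \<alpha>min \<alpha>max \<kappa> r tmin Lmax :: real
    and xaux :: "real^'n"
    and x v d :: "nat \<Rightarrow> real^'n"
    and \<alpha> l ab lb :: "nat \<Rightarrow> real^'m"
    and H :: "nat \<Rightarrow> real^2^2"
    and z :: "nat \<Rightarrow> real^2"
    and t :: "nat \<Rightarrow> real"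
  assumes differentiable: "F differentiable_on UNIV"
    and C1: "continuous_on UNIV (\<lambda>p. jacobian F (at p))"
    and lipschitz: "\<And>i. (L i)-lipschitz_on UNIV (grad F i)"
    and c: "0 < c1" "c1 \<le> c2"
    and sigma: "0 < \<sigma>1" "\<sigma>1 \<le> \<sigma>2" "\<sigma>2 < 1"
    and alpha: "0 < \<alpha>min" "\<alpha>min < \<alpha>max"
    and kappa: "\<kappa> > 0"
    and error_bound: "\<And>a p w. (\<forall>i. \<alpha>min \<le> a $ i \<and> a $ i \<le> \<alpha>max) \<Longrightarrow> is_BB_direction F a p w \<Longrightarrow>
           merit F p \<le> ereal (\<kappa> * (norm w)\<^sup>2)"
    and run: "SMBBMO_run F c1 c2 \<sigma>1 \<sigma>2 \<alpha>min \<alpha>max xaux x \<alpha> v l ab lb H z d t"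
    and not_critical: "\<And>k. \<not> pareto_critical F (x k)"
    and spectral_bounds: "\<And>k. k \<ge> 1 \<Longrightarrow>
           c1 \<le> lambda_min (scaled (scaling (v k) (x k - x (k - 1))) (H k)) \<and>
           lambda_min (scaled (scaling (v k) (x k - x (k - 1))) (H k))
             \<le> lambda_max (scaled (scaling (v k) (x k - x (k - 1))) (H k)) \<and>
           lambda_max (scaled (scaling (v k) (x k - x (k - 1))) (H k)) \<le> c2"
    and Lmax: "Lmax = (MAX i. L i)"
    and tmin: "tmin = (1 - \<sigma>2) * c1 * \<alpha>min / (2 * Lmax)"
    and r: "r = \<sigma>1 * tmin * \<alpha>min ^ 3 / (c2 * \<kappa> * \<alpha>max\<^sup>2)"
  shows "\<forall>k. merit F (x (Suc k)) \<le> ereal (1 - r) * merit F (x k)"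
proof
  fix k
  note run' = run[unfolded SMBBMO_run_def]
  have dir: "is_BB_direction F (\<alpha> k) (x k) (v k)" and v: "v k \<noteq> 0" for k
    using run' by blast+
  have wolfe: "0 < t k" "wolfe F \<sigma>1 \<sigma>2 (ab k) (x k) (d k) (t k)" for k
    using run' by blast+
  have step: "x (Suc k) = x k + t k *\<^sub>R d k" for k
    using run' by blast
  have zero: "d 0 = v 0" "ab 0 = \<alpha> 0" using run' by blast+
  define s where "s k = x k - x (k - 1)" for k
  have sub: "H k = subspace_matrix F c1 c2 (lb (k - 1)) (ab (k - 1)) (x (k - 1)) (x k) (v k)"
      "ab k = subspace_parameters F \<alpha>min \<alpha>max (lb (k - 1)) (ab (k - 1)) (x (k - 1)) (x k)"
      "is_subspace_solution F (ab k) (x k) (v k) (s k) (H k) (z k)"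
      "d k = z k $ 1 *\<^sub>R v k + z k $ 2 *\<^sub>R s k" if "1 \<le> k" for k
    using run' that unfolding Let_def s_def by blast+
  have \<alpha>: "\<alpha>min \<le> \<alpha> k $ i" "\<alpha> k $ i \<le> \<alpha>max" for k i
  proof -
    have "\<alpha> k = BB_parameters F \<alpha>min \<alpha>max (case k of 0 \<Rightarrow> xaux | Suc j \<Rightarrow> x j) (x k)"
      using run' by blast
    then show "\<alpha>min \<le> \<alpha> k $ i" "\<alpha> k $ i \<le> \<alpha>max"
      using safeguard_bounds[of \<alpha>min \<alpha>max] alpha by (simp_all add: BB_parameters_def Let_def)
  qed
  have ab: "\<alpha>min \<le> ab k $ i" "ab k $ i \<le> \<alpha>max" for k i
    using safeguard_bounds[of \<alpha>min \<alpha>max] alpha zero \<alpha> sub(2)[of k]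
    by (cases "k = 0"; simp add: subspace_parameters_def Let_def)+
  have abpos: "0 < ab k $ i" for k i using ab alpha by (meson less_le_trans)
  have slope_v: "max_slope F (ab k) (x k) (v k) \<le> - (\<alpha>min / \<alpha>max * (norm (v k))\<^sup>2)" for k
    by (rule max_slope_change_parameters[where a = "\<alpha> k"])
      (use is_BB_direction_slope[OF dir] \<alpha> ab abpos alpha in auto)
  have neg_v: "max_slope F (ab k) (x k) (v k) < 0" for k
  proof -
    have "0 < \<alpha>min / \<alpha>max * (norm (v k))\<^sup>2" using alpha v[of k] by simp
    then show ?thesis using slope_v[of k] by linarith
  qed
  have H: "\<exists>C::real^2^2. H k = scaling (v k) (s k) ** (C ** transpose C) ** scaling (v k) (s k)" if "1 \<le> k" for k
    unfolding sub(1)[OF that] s_def by (rule subspace_matrix_eq_congruence)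
  have d: "d k \<noteq> 0" for k
  proof (cases "k = 0")
    case False
    then have k: "1 \<le> k" by simp
    have "0 \<le> w \<bullet> (H k *v w)" for w
      using H[OF k] gram_form_nonneg by (metis matrix_form_congruence transpose_scaling)
    then show ?thesis
      using subspace_direction_nonzero[OF sub(3)[OF k] neg_v] sub(4)[OF k] by simp
  qed (use zero v in simp)
  have s: "s k \<noteq> 0" if "1 \<le> k" for k
    using step[of "k - 1"] d[of "k - 1"] wolfe(1)[of "k - 1"] that by (simp add: s_def)
  have Lnonneg: "0 \<le> Lmax"
  proof -
    have "0 \<le> L undefined" using lipschitz lipschitz_on_nonneg by blast
    also have "\<dots> \<le> Lmax" unfolding Lmax by (rule Max_ge) auto
    finally show ?thesis .
  qed
  have rpos: "0 \<le> r" using Lnonneg c sigma alpha kappa by (simp add: r tmin)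
  \<comment> \<open>\<open>\<gamma>\<close> and \<open>\<eta>\<close> measure the descent against \<open>d k\<close> and \<open>v k\<close>; the product required of them is the one
    that occurs in \<open>r\<close>.\<close>
  obtain \<gamma> \<eta> where ge: "\<gamma> * (norm (d k))\<^sup>2 \<le> - max_slope F (ab k) (x k) (d k)"
      "\<eta> * (norm (v k))\<^sup>2 \<le> - max_slope F (ab k) (x k) (d k)"
      "0 \<le> \<gamma>" "0 \<le> \<eta>" "c1 / 2 * ((\<alpha>min / \<alpha>max)\<^sup>2 / c2) \<le> \<gamma> * \<eta>"
  proof (cases "k = 0")
    case True
    \<comment> \<open>The first step is a pure Barzilai-Borwein step. No matrix occurs in it, and both constants are
      \<open>1\<close>, which is enough because \<open>c1 \<le> c2\<close> and \<open>\<alpha>min \<le> \<alpha>max\<close>.\<close>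
    have "(c1 / c2) * (\<alpha>min / \<alpha>max)\<^sup>2 \<le> 1 * 1"
      using c alpha by (intro mult_mono power_le_one) auto
    then have le: "(c1 / c2) * (\<alpha>min / \<alpha>max)\<^sup>2 / 2 \<le> 1 / 2" by (intro divide_right_mono) simp_all
    have "c1 / 2 * ((\<alpha>min / \<alpha>max)\<^sup>2 / c2) = (c1 / c2) * (\<alpha>min / \<alpha>max)\<^sup>2 / 2" by simp
    also have "\<dots> \<le> 1 / 2" by (rule le)
    also have "\<dots> \<le> 1 * (1::real)" by simp
    finally have "c1 / 2 * ((\<alpha>min / \<alpha>max)\<^sup>2 / c2) \<le> 1 * 1" .
    then show ?thesis
      using is_BB_direction_slope[OF dir[of 0]] zero True by (intro that[of 1 1]) simp_all
  next
    case False
    then have k: "1 \<le> k" by simp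
    obtain C :: "real^2^2" where C: "H k = scaling (v k) (s k) ** (C ** transpose C) ** scaling (v k) (s k)"
      using H[OF k] by blast
    have sym: "transpose (C ** transpose C) = C ** transpose C"
      by (simp add: matrix_transpose_mul)
    have \<rho>: "0 \<le> \<alpha>min / \<alpha>max" and c2: "0 < c2" using alpha c by auto
    note bounds = spectral_bounds[OF k, folded s_def]
    show ?thesis
    proof (rule that)
      show "c1 / 2 * (norm (d k))\<^sup>2 \<le> - max_slope F (ab k) (x k) (d k)"
        "(\<alpha>min / \<alpha>max)\<^sup>2 / c2 * (norm (v k))\<^sup>2 \<le> - max_slope F (ab k) (x k) (d k)"
        unfolding sub(4)[OF k]
        using subspace_direction_slope_bounds[OF sub(3)[OF k] C sym v s[OF k] c(1) _ _ c2 slope_v \<rho>] bounds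
        by blast+
    qed (use c in simp_all)
  qed
  have "r = \<sigma>1 * ((1 - \<sigma>2) * \<alpha>min / Lmax) * \<alpha>min / \<kappa> * (c1 / 2 * ((\<alpha>min / \<alpha>max)\<^sup>2 / c2))"
    by (simp add: r tmin power2_eq_square power3_eq_cube mult_ac)
  also have "\<dots> \<le> \<sigma>1 * ((1 - \<sigma>2) * \<alpha>min / Lmax) * \<alpha>min / \<kappa> * (\<gamma> * \<eta>)"
    using ge sigma alpha kappa Lnonneg by (intro mult_left_mono) auto
  finally have "r \<le> \<sigma>1 * ((1 - \<sigma>2) * \<gamma> * \<alpha>min / (MAX i. L i)) * \<alpha>min * \<eta> / \<kappa>"
    by (simp add: Lmax mult_ac)
  then show "merit F (x (Suc k)) \<le> ereal (1 - r) * merit F (x k)"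
    unfolding step
    using merit_contraction_wolfe[OF lipschitz alpha(1) ab(1) wolfe(2,1) sigma(1,3) ge(1,2,3,4) _ kappa d _ rpos]
      error_bound[OF _ dir] \<alpha> by simp
qed

end
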